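(* Let $(X,\mathcal{A},\mathbf{P})$ be a probability space and let $\Phi=\Phi(u)$ be an exponential Young–Orlicz function. Then: A. The weak Orlicz space $wL\Phi$ coincides, as a set and with equivalence of norms, with the ordinary (exponential) Orlicz space $L(\Phi)$; that is, $wL\Phi=L(\Phi)$ and there are constants $0<c\le C<\infty$ such that $c\,\|f\|_{L(\Phi)}\le\|f\|_{wL\Phi}\le C\,\|f\|_{L(\Phi)}$ for all $f\in L(\Phi)$. B. The weak Orlicz space $wM\Phi$ coincides, as a set and with equivalence of norms, with the subspace $E(\Phi)$ of $L(\Phi)$; that is, $wM\Phi=E(\Phi)$ and the functionals $\|\cdot\|_{wL\Phi}$ and $\|\cdot\|_{L(\Phi)}$ are equivalent on it.
   Context: A function $N:\mathbb{R}\to[0,\infty)$ is called an exponential Young–Orlicz function if $N(u)=e^{\nu(u)}-1$, where $\nu$ is an even, twice continuously differentiable, convex function, strictly increasing on the right half-axis, such that $\nu(u)=0\Leftrightarrow u=0$, $\nu'(0)=0$, and $\lim_{u\to\infty}\nu'(u)=\infty$. For measurable $f:X\to\mathbb{R}$ put $T_f(t)=\mathbf{P}\{x:|f(x)|\ge t\}$, $t\ge0$. The Orlicz space $L(\Phi)$ consists of all measurable $f$ with finite (Luxemburg) norm $\|f\|_{L(\Phi)}=\inf\{u>0:\int_X\Phi(|f(x)|/u)\,\mathbf{P}(dx)\le1\}$. The subspace $E(\Phi)\subset L(\Phi)$ is the closure in $L(\Phi)$ of the set of all bounded measurable functions (supported on sets of finite measure, which is automatic here), equipped with the norm of $L(\Phi)$.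 The weak Orlicz spaces are $$ \|f\|_{wL\Phi}=\inf\Big\{c>0:\ \sup_{t>0}\,[\Phi(t/c)\,T_f(t)]\le1\Big\},\qquad wL\Phi=\{f:\|f\|_{wL\Phi}<\infty\}, $$ $$ wM\Phi=\Big\{f:\ \forall c>0\ \ \sup_{t>0}\,[\Phi(t/c)\,T_f(t)]<\infty\Big\}, $$ where $wM\Phi$ is equipped with the functional $\|\cdot\|_{wL\Phi}$. *)

theory Defs
  imports "HOL-Probability.Probability"
begin

definition exp_young_orlicz :: "(real \<Rightarrow> real) \<Rightarrow> bool" where
  "exp_young_orlicz N \<longleftrightarrow>
     (\<exists>\<nu> \<nu>' \<nu>'' :: real \<Rightarrow> real.
        (\<forall>u. N u = exp (\<nu> u) - 1) \<and>
        (\<forall>u. \<nu> (- u) = \<nu> u) \<and>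
        (\<forall>u. (\<nu> has_real_derivative \<nu>' u) (at u)) \<and>
        (\<forall>u. (\<nu>' has_real_derivative \<nu>'' u) (at u)) \<and>
        continuous_on UNIV \<nu>'' \<and>
        convex_on UNIV \<nu> \<and>
        strict_mono_on {0..} \<nu> \<and>
        (\<forall>u. \<nu> u = 0 \<longleftrightarrow> u = 0) \<and>
        \<nu>' 0 = 0 \<and>
        filterlim \<nu>' at_top at_top)"

definition tail_fun :: "'a measure \<Rightarrow> ('a \<Rightarrow> real) \<Rightarrow> real \<Rightarrow> real" where
  "tail_fun M f t = measure M {x \<in> space M. \<bar>f x\<bar> \<ge> t}"

text \<open>The functionals below take values in \<^typ>\<open>ennreal\<close>, so that the infimum over an empty
  set of admissible constants is infinite. Elements of the spaces are functions, not classes of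
  functions modulo equality almost everywhere.\<close>

definition orlicz_norm :: "'a measure \<Rightarrow> (real \<Rightarrow> real) \<Rightarrow> ('a \<Rightarrow> real) \<Rightarrow> ennreal" where
  "orlicz_norm M \<Phi> f =
     (INF u \<in> {u :: real. 0 < u \<and> (\<integral>\<^sup>+ x. ennreal (\<Phi> (\<bar>f x\<bar> / u)) \<partial>M) \<le> 1}. ennreal u)"

definition orlicz_space :: "'a measure \<Rightarrow> (real \<Rightarrow> real) \<Rightarrow> ('a \<Rightarrow> real) set" where
  "orlicz_space M \<Phi> = {f \<in> borel_measurable M. orlicz_norm M \<Phi> f < \<infinity>}"

definition bounded_measurable :: "'a measure \<Rightarrow> ('a \<Rightarrow> real) set" where
  "bounded_measurable M =
     {g \<in> borel_measurable M. bounded (g ` space M) \<and> emeasure M {x \<in> space M. g x \<noteq> 0} < \<infinity>}"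

definition orlicz_E :: "'a measure \<Rightarrow> (real \<Rightarrow> real) \<Rightarrow> ('a \<Rightarrow> real) set" where
  "orlicz_E M \<Phi> = {f \<in> orlicz_space M \<Phi>.
     \<forall>e > 0. \<exists>g \<in> bounded_measurable M. orlicz_norm M \<Phi> (\<lambda>x. f x - g x) < e}"

definition weak_sup :: "'a measure \<Rightarrow> (real \<Rightarrow> real) \<Rightarrow> ('a \<Rightarrow> real) \<Rightarrow> real \<Rightarrow> ennreal" where
  "weak_sup M \<Phi> f c = (SUP t \<in> {0<..}. ennreal (\<Phi> (t / c) * tail_fun M f t))"

definition weak_orlicz_norm :: "'a measure \<Rightarrow> (real \<Rightarrow> real) \<Rightarrow> ('a \<Rightarrow> real) \<Rightarrow> ennreal" where
  "weak_orlicz_norm M \<Phi> f = (INF c \<in> {c :: real. 0 < c \<and> weak_sup M \<Phi> f c \<le> 1}. ennreal c)"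

definition weak_orlicz_L :: "'a measure \<Rightarrow> (real \<Rightarrow> real) \<Rightarrow> ('a \<Rightarrow> real) set" where
  "weak_orlicz_L M \<Phi> = {f \<in> borel_measurable M. weak_orlicz_norm M \<Phi> f < \<infinity>}"

definition weak_orlicz_M :: "'a measure \<Rightarrow> (real \<Rightarrow> real) \<Rightarrow> ('a \<Rightarrow> real) set" where
  "weak_orlicz_M M \<Phi> = {f \<in> borel_measurable M. \<forall>c > 0. weak_sup M \<Phi> f c < \<infinity>}"

definition equivalent_on ::
    "'b set \<Rightarrow> ('b \<Rightarrow> ennreal) \<Rightarrow> ('b \<Rightarrow> ennreal) \<Rightarrow> bool" where
  "equivalent_on S p q \<longleftrightarrow>
     (\<exists>c C :: real. 0 < c \<and> c \<le> C \<and>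
        (\<forall>f \<in> S. ennreal c * p f \<le> q f \<and> q f \<le> ennreal C * p f))"

end

theory Submission
  imports Defs
begin

text \<open>One inclusion is Markov's inequality. For the other, put \<open>Y = \<nu>(\<bar>f\<bar>/c)\<close>: a bound on
  \<open>\<Phi>(t/c) T\<^sub>f(t)\<close> is a bound on \<open>e\<^sup>s P(Y \<ge> s)\<close>, so \<open>e\<^bsup>Y/2\<^esup>\<close> is integrable, while
  convexity of \<open>\<nu>\<close> gives \<open>\<Phi>(\<bar>f\<bar>/(2c)) \<le> e\<^bsup>Y/2\<^esup>\<close>. For part B, this integrability at every
  scale makes the truncations of \<open>f\<close> converge to \<open>f\<close> in the Orlicz norm; conversely, if \<open>f - g\<close> has
  small norm with \<open>g\<close> bounded by \<open>b\<close>, then \<open>\<bar>f\<bar> \<ge> t\<close> forces \<open>\<bar>f - g\<bar> \<ge> t/2\<close> once \<open>t \<ge> 2b\<close>.\<close>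

section \<open>Growth and convexity of exponential Young-Orlicz functions\<close>

lemma exp_young_orliczE:
  assumes "exp_young_orlicz \<Phi>"
  obtains \<nu> where "\<And>u. \<Phi> u = exp (\<nu> u) - 1"
    and "continuous_on UNIV \<nu>"
    and "\<nu> 0 = 0"
    and "\<And>x y. 0 \<le> x \<Longrightarrow> x < y \<Longrightarrow> \<nu> x < \<nu> y"
    and "\<And>x m. 1 \<le> m \<Longrightarrow> \<nu> (x / m) \<le> \<nu> x / m"
    and "\<And>s. 0 \<le> s \<Longrightarrow> \<exists>x\<ge>0. \<nu> x = s"
proof -
  obtain \<nu> \<nu>' \<nu>'' :: "real \<Rightarrow> real" where N: "\<And>u. \<Phi> u = exp (\<nu> u) - 1"
    and d: "\<And>u. (\<nu> has_real_derivative \<nu>' u) (at u)"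
    and cv: "convex_on UNIV \<nu>" and sm: "strict_mono_on {0..} \<nu>"
    and z: "\<And>u. \<nu> u = 0 \<longleftrightarrow> u = 0"
    using assms unfolding exp_young_orlicz_def by metis
  have cont: "continuous_on UNIV \<nu>"
    using d by (meson DERIV_isCont continuous_at_imp_continuous_on)
  have z0: "\<nu> 0 = 0" using z by simp
  have mono: "\<nu> x < \<nu> y" if "0 \<le> x" "x < y" for x y
    using strict_mono_onD[OF sm, of x y] that by auto
  \<comment> \<open>\<open>x / m\<close> is the convex combination of \<open>x\<close> and 0 with
    weights \<open>1 / m\<close> and \<open>1 - 1 / m\<close>, and
    \<open>\<nu> 0 = 0\<close>.\<close>
  have scale: "\<nu> (x / m) \<le> \<nu> x / m" if "1 \<le> m" for x m
    using convex_onD[OF cv, of "1 / m" 0 x] that z0 by simp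
  have surj: "\<exists>x\<ge>0. \<nu> x = s" if s: "0 \<le> s" for s
  proof -
    have p: "0 < \<nu> 1" using strict_mono_onD[OF sm, of 0 1] z0 by simp
    \<comment> \<open>Convexity through the origin forces at least linear growth,
      \<open>m * \<nu> 1 \<le> \<nu> m\<close>. So \<open>m = s / \<nu> 1\<close> would already
      reach \<open>s\<close>; the maximum with 1 keeps \<open>scale\<close> applicable. The
      intermediate value theorem on \<open>{0..m}\<close> then finishes.\<close>
    define m where "m = max 1 (s / \<nu> 1)"
    have m: "1 \<le> m" "s / \<nu> 1 \<le> m" by (auto simp: m_def)
    have "\<nu> 1 \<le> \<nu> m / m" using scale[OF m(1), of m] m by simp
    then have "m * \<nu> 1 \<le> \<nu> m" using m by (simp add: field_simps)
    moreover have "s \<le> m * \<nu> 1" using m p by (simp add: field_simps)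
    ultimately have "\<nu> 0 \<le> s" "s \<le> \<nu> m" using s z0 by auto
    then show ?thesis
      using IVT'[of \<nu> 0 s m] m continuous_on_subset[OF cont] by fastforce
  qed
  show ?thesis by (rule that[of \<nu>]) (use N cont z0 mono scale surj in auto)
qed

lemma exp_young_orlicz_mono:
  assumes "exp_young_orlicz \<Phi>" "0 \<le> x" "x \<le> y"
  shows "\<Phi> x \<le> \<Phi> y"
proof -
  obtain \<nu> where "\<And>u. \<Phi> u = exp (\<nu> u) - 1" "\<And>x y. 0 \<le> x \<Longrightarrow> x < y \<Longrightarrow> \<nu> x < \<nu> y"
    using assms(1) by (rule exp_young_orliczE) blast
  then show ?thesis using assms(2,3) by (cases "x = y") (auto simp: less_imp_le)
qed

lemma exp_young_orlicz_zero: "exp_young_orlicz \<Phi> \<Longrightarrow> \<Phi> 0 = 0"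
  by (auto elim!: exp_young_orliczE)

lemma exp_young_orlicz_nonneg: "exp_young_orlicz \<Phi> \<Longrightarrow> 0 \<le> x \<Longrightarrow> 0 \<le> \<Phi> x"
  using exp_young_orlicz_mono[of \<Phi> 0 x] exp_young_orlicz_zero[of \<Phi>] by simp

lemma exp_young_orlicz_measurable: 
  assumes "exp_young_orlicz \<Phi>"
  shows "\<Phi> \<in> borel_measurable borel"
proof -
  obtain \<nu> where N: "\<And>u. \<Phi> u = exp (\<nu> u) - 1" and c: "continuous_on UNIV \<nu>"
    using assms by (rule exp_young_orliczE) blast
  have "\<Phi> = (\<lambda>u. exp (\<nu> u) - 1)" using N by auto
  then show ?thesis
    using borel_measurable_continuous_onI[OF c] by simp
qed

lemma exp_divide_minus_one_le:
  fixes y m :: real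
  assumes "1 \<le> m"
  shows "exp (y / m) - 1 \<le> (exp y - 1) / m"
  using convex_onD[OF exp_convex, of "1 / m" 0 y] assms by (simp add: field_simps)

text \<open>Scaling for \<open>\<nu>\<close> followed by the same scaling for
  \<open>exp y - 1\<close>. This is what trades a large bound on the integral of
  \<open>\<Phi>\<close> for a larger scale.\<close>

lemma exp_young_orlicz_scale:
  assumes "exp_young_orlicz \<Phi>" "1 \<le> m"
  shows "\<Phi> (x / m) \<le> \<Phi> x / m"
proof -
  obtain \<nu> where N: "\<And>u. \<Phi> u = exp (\<nu> u) - 1" 
    and sc: "\<And>x m. 1 \<le> m \<Longrightarrow> \<nu> (x / m) \<le> \<nu> x / m"
    using assms(1) by (rule exp_young_orliczE) blast
  show ?thesis
    using sc[OF assms(2), of x] exp_divide_minus_one_le[OF assms(2), of "\<nu> x"] N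
    by (smt (verit) exp_le_cancel_iff)
qed

section \<open>Tail bounds against integrals of \<open>\<Phi>\<close>\<close>

lemma weak_sup_le_nn_integral:
  assumes P: "exp_young_orlicz \<Phi>" and "prob_space M" and f: "f \<in> borel_measurable M" and c: "0 < c"
  shows "weak_sup M \<Phi> f c \<le> (\<integral>\<^sup>+ x. ennreal (\<Phi> (\<bar>f x\<bar> / c)) \<partial>M)"
  unfolding weak_sup_def
proof (rule SUP_least)
  interpret prob_space M by fact
  note [measurable] = f exp_young_orlicz_measurable[OF P]
  fix t :: real assume "t \<in> {0<..}"
  then have t: "0 < t" by simp
  have n: "0 \<le> \<Phi> (t / c)" using exp_young_orlicz_nonneg[OF P] t c by simp
  \<comment> \<open>The left side is the integral of a step function lying below the integrand,
    since \<open>\<Phi>\<close> is increasing on the half-axis.\<close>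
  have "ennreal (\<Phi> (t / c) * tail_fun M f t) =
      (\<integral>\<^sup>+ x. ennreal (\<Phi> (t / c)) * indicator {x \<in> space M. \<bar>f x\<bar> \<ge> t} x \<partial>M)"
    by (subst nn_integral_cmult_indicator)
      (auto simp: tail_fun_def n ennreal_mult emeasure_eq_measure)
  also have "\<dots> \<le> (\<integral>\<^sup>+ x. ennreal (\<Phi> (\<bar>f x\<bar> / c)) \<partial>M)"
    using t c by (intro nn_integral_mono)
      (auto simp: indicator_def divide_right_mono intro!: ennreal_leI exp_young_orlicz_mono[OF P])
  finally show "ennreal (\<Phi> (t / c) * tail_fun M f t) \<le> \<dots>" .
qed

lemma weak_sup_leD:
  assumes "weak_sup M \<Phi> f c \<le> ennreal A" "0 \<le> A" "0 < t"
  shows "\<Phi> (t / c) * tail_fun M f t \<le> A"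
proof -
  have "ennreal (\<Phi> (t / c) * tail_fun M f t) \<le> weak_sup M \<Phi> f c"
    unfolding weak_sup_def by (rule SUP_upper) (use assms in auto)
  then show ?thesis using assms by (metis ennreal_le_iff order_trans)
qed

text \<open>A geometric series of ratio \<open>exp (- 1/2)\<close>. The first factor of a term
  bounds \<open>exp (Y / 2)\<close> where \<open>Y \<le> n + 1\<close>, the second is the decay of
  the probability of \<open>Y \<ge> n\<close>.\<close>

definition tail_const :: real where
  "tail_const = (\<Sum>n. exp ((real n + 1) / 2) * exp (- real n))"

lemma tail_const_sums: "(\<lambda>n. exp ((real n + 1) / 2) * exp (- real n)) sums tail_const"
proof -
  have "(\<lambda>n. exp ((real n + 1) / 2) * exp (- real n)) = (\<lambda>n. exp (1/2) * exp (- 1/2) ^ n)"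
    by (rule ext) (simp add: exp_of_nat_mult[symmetric] exp_add[symmetric] field_simps)
  moreover have "summable (\<lambda>n. exp (1/2) * exp (- 1/2 :: real) ^ n)"
    by (intro summable_mult summable_geometric) simp
  ultimately show ?thesis unfolding tail_const_def by (simp add: summable_sums)
qed

lemma tail_const_nonneg: "0 \<le> tail_const"
  unfolding tail_const_def by (intro suminf_nonneg sums_summable[OF tail_const_sums]) simp

text \<open>Doubling the scale halves the exponent, so the growth \<open>exp (Y / 2)\<close> is
  summable against the tail \<open>exp (- n)\<close> over the integer levels of \<open>Y\<close>.
  The bound depends on \<open>A\<close> alone, which later makes the norm constants uniform in
  \<open>f\<close>.\<close>

lemma nn_integral_le_weak_sup:
  assumes P: "exp_young_orlicz \<Phi>" and "prob_space M" and f: "f \<in> borel_measurable M" and c: "0 < c"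
    and A: "0 \<le> A" and w: "weak_sup M \<Phi> f c \<le> ennreal A"
  shows "(\<integral>\<^sup>+ x. ennreal (\<Phi> (\<bar>f x\<bar> / (2 * c))) \<partial>M) \<le> ennreal ((A + 1) * tail_const)"
proof -
  interpret prob_space M by fact
  obtain \<nu> where N: "\<And>u. \<Phi> u = exp (\<nu> u) - 1" and cont: "continuous_on UNIV \<nu>"
    and z: "\<nu> 0 = 0" and strict: "\<And>x y. 0 \<le> x \<Longrightarrow> x < y \<Longrightarrow> \<nu> x < \<nu> y"
    and sc: "\<And>x m. 1 \<le> m \<Longrightarrow> \<nu> (x / m) \<le> \<nu> x / m"
    and surj: "\<And>s. 0 \<le> s \<Longrightarrow> \<exists>x\<ge>0. \<nu> x = s"
    using P by (rule exp_young_orliczE) blast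
  note [measurable] = f borel_measurable_continuous_onI[OF cont]
  define Y where "Y x = \<nu> (\<bar>f x\<bar> / c)" for x
  have [measurable]: "Y \<in> borel_measurable M" unfolding Y_def by measurable
  have Y0: "0 \<le> Y x" for x
    using strict[of 0 "\<bar>f x\<bar> / c"] c z by (cases "f x = 0") (auto simp: Y_def less_imp_le)
  \<comment> \<open>The hypothesis controls \<open>exp n - 1\<close> times the tail; adding the tail
    itself, at most 1, turns \<open>A\<close> into \<open>A + 1\<close>. The level 0 is separate
    because the supremum runs over \<open>t > 0\<close> only, and there the trivial bound 1 is
    enough.\<close>
  have T: "measure M {x \<in> space M. real n \<le> Y x} \<le> (A + 1) * exp (- real n)" for n
  proof (cases "n = 0")
    case True
    have "measure M {x \<in> space M. real n \<le> Y x} \<le> 1" by simp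
    also have "1 \<le> (A + 1) * exp (- real n)" using True A by simp
    finally show ?thesis .
  next
    case False
    \<comment> \<open>\<open>x0\<close> is the point where \<open>\<nu>\<close> takes the value
      \<open>n\<close>, so \<open>Y \<ge> n\<close> amounts to
      \<open>\<bar>f\<bar> \<ge> x0 * c\<close>, to which the weak bound applies.\<close>
    obtain x0 where x0: "0 \<le> x0" "\<nu> x0 = real n" using surj[of "real n"] by auto
    have pos: "0 < x0 * c" using x0 z False c by (cases "x0 = 0") auto
    have "{x \<in> space M. real n \<le> Y x} \<subseteq> {x \<in> space M. \<bar>f x\<bar> \<ge> x0 * c}"
    proof safe
      fix x assume x: "real n \<le> Y x"
      show "x0 * c \<le> \<bar>f x\<bar>"
      proof (rule ccontr)
        assume "\<not> ?thesis"
        then have "\<bar>f x\<bar> / c < x0" using c by (simp add: field_simps)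
        then show False using strict[of "\<bar>f x\<bar> / c" x0] c x x0 by (simp add: Y_def)
      qed
    qed
    then have "measure M {x \<in> space M. real n \<le> Y x} \<le> tail_fun M f (x0 * c)"
      unfolding tail_fun_def by (intro finite_measure_mono) auto
    also have "\<dots> \<le> (A + 1) * exp (- real n)"
    proof -
      have "(exp (real n) - 1) * tail_fun M f (x0 * c) \<le> A"
        using weak_sup_leD[OF w A pos] N x0 c by simp
      moreover have "tail_fun M f (x0 * c) \<le> 1" by (simp add: tail_fun_def)
      ultimately have "exp (real n) * tail_fun M f (x0 * c) \<le> A + 1" by (simp add: algebra_simps)
      then show ?thesis by (simp add: exp_minus field_simps)
    qed
    finally show ?thesis .
  qed
  \<comment> \<open>The level sets are nested, not disjoint layers; overcounting is harmless for an
    upper bound. The single term with \<open>k\<close> the integer part of \<open>Y x\<close>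
    already dominates the left side.\<close>
  have le: "ennreal (\<Phi> (\<bar>f x\<bar> / (2 * c))) \<le>
      (\<Sum>n. ennreal (exp ((real n + 1) / 2)) * indicator {x \<in> space M. real n \<le> Y x} x)"
    (is "_ \<le> (\<Sum>n. ?g n)") if x: "x \<in> space M" for x
  proof -
    define k where "k = nat \<lfloor>Y x\<rfloor>"
    have k: "real k \<le> Y x" "Y x \<le> real k + 1"
      using Y0[of x] unfolding k_def by linarith+
    have "\<nu> (\<bar>f x\<bar> / (2 * c)) \<le> Y x / 2"
      using sc[of 2 "\<bar>f x\<bar> / c"] by (simp add: Y_def mult.commute)
    then have "\<nu> (\<bar>f x\<bar> / (2 * c)) \<le> (real k + 1) / 2" using k by simp
    then have "\<Phi> (\<bar>f x\<bar> / (2 * c)) \<le> exp ((real k + 1) / 2)"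
      unfolding N by (smt (verit) exp_le_cancel_iff)
    then have "ennreal (\<Phi> (\<bar>f x\<bar> / (2 * c))) \<le> ?g k"
      using k x by (simp add: ennreal_leI)
    also have "?g k = sum ?g {k}"
      by (simp only: sum.insert sum.empty finite.emptyI empty_iff not_False_eq_True add_0_right)
    also have "\<dots> \<le> (\<Sum>n. ?g n)"
      by (rule sum_le_suminf) auto
    finally show ?thesis .
  qed
  have "(\<integral>\<^sup>+ x. ennreal (\<Phi> (\<bar>f x\<bar> / (2 * c))) \<partial>M) \<le>
      (\<integral>\<^sup>+ x. (\<Sum>n. ennreal (exp ((real n + 1) / 2)) * indicator {x \<in> space M. real n \<le> Y x} x) \<partial>M)"
    by (intro nn_integral_mono le)
  also have "\<dots> = (\<Sum>n. ennreal (exp ((real n + 1) / 2) * measure M {x \<in> space M. real n \<le> Y x}))"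
    by (subst nn_integral_suminf)
      (auto simp: nn_integral_cmult_indicator emeasure_eq_measure ennreal_mult)
  also have "\<dots> \<le> (\<Sum>n. ennreal ((A + 1) * (exp ((real n + 1) / 2) * exp (- real n))))"
  proof (intro suminf_le ennreal_leI summableI)
    fix n
    show "exp ((real n + 1) / 2) * measure M {x \<in> space M. real n \<le> Y x} \<le>
        (A + 1) * (exp ((real n + 1) / 2) * exp (- real n))"
      using mult_left_mono[OF T, of "exp ((real n + 1) / 2)" n] by (simp add: mult_ac)
  qed
  also have "\<dots> = ennreal ((A + 1) * tail_const)"
    using A by (intro suminf_ennreal_eq sums_mult tail_const_sums) auto
  finally show ?thesis .
qed

section \<open>Comparison of the Luxemburg and weak norms\<close>

lemma orlicz_norm_le:
  assumes "0 < u" "(\<integral>\<^sup>+ x. ennreal (\<Phi> (\<bar>f x\<bar> / u)) \<partial>M) \<le> 1"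
  shows "orlicz_norm M \<Phi> f \<le> ennreal u"
  unfolding orlicz_norm_def by (rule INF_lower) (use assms in auto)

text \<open>By Markov's inequality every scale admissible for the Luxemburg infimum is admissible
  for the weak one, so the latter infimum runs over a larger set.\<close>

lemma weak_orlicz_norm_le_orlicz_norm:
  assumes P: "exp_young_orlicz \<Phi>" and M: "prob_space M" and f: "f \<in> borel_measurable M"
  shows "weak_orlicz_norm M \<Phi> f \<le> orlicz_norm M \<Phi> f"
  unfolding weak_orlicz_norm_def orlicz_norm_def
  by (rule INF_superset_mono) (auto intro: order_trans[OF weak_sup_le_nn_integral[OF P M f]])

text \<open>Enlarging the scale by \<open>m\<close> divides the integral by at least
  \<open>m\<close>, which brings it from \<open>B\<close> down to at most 1.\<close>

lemma orlicz_norm_le_of_nn_integral: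
  assumes P: "exp_young_orlicz \<Phi>" and c: "0 < c"
    and B: "(\<integral>\<^sup>+ x. ennreal (\<Phi> (\<bar>f x\<bar> / c)) \<partial>M) \<le> ennreal B" and m: "1 \<le> m" "B \<le> m"
    and f: "f \<in> borel_measurable M"
  shows "orlicz_norm M \<Phi> f \<le> ennreal (c * m)"
proof (rule orlicz_norm_le)
  note [measurable] = f exp_young_orlicz_measurable[OF P]
  show "0 < c * m" using c m by simp
  have "ennreal (\<Phi> (\<bar>f x\<bar> / (c * m))) \<le> ennreal (1 / m) * ennreal (\<Phi> (\<bar>f x\<bar> / c))" for x
    using exp_young_orlicz_scale[OF P m(1), of "\<bar>f x\<bar> / c"] m
    by (simp add: ennreal_mult'[symmetric] ennreal_leI)
  then have "(\<integral>\<^sup>+ x. ennreal (\<Phi> (\<bar>f x\<bar> / (c * m))) \<partial>M) \<le>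
      (\<integral>\<^sup>+ x. ennreal (1 / m) * ennreal (\<Phi> (\<bar>f x\<bar> / c)) \<partial>M)"
    by (intro nn_integral_mono)
  also have "\<dots> = ennreal (1 / m) * (\<integral>\<^sup>+ x. ennreal (\<Phi> (\<bar>f x\<bar> / c)) \<partial>M)"
    by (rule nn_integral_cmult) measurable
  also have "\<dots> \<le> ennreal (1 / m) * ennreal m"
    using m by (intro mult_left_mono order_trans[OF B] ennreal_leI) auto
  also have "\<dots> = 1" using m by (simp add: ennreal_mult'[symmetric])
  finally show "(\<integral>\<^sup>+ x. ennreal (\<Phi> (\<bar>f x\<bar> / (c * m))) \<partial>M) \<le> 1" .
qed

text \<open>The factor 2 is the doubled scale. With \<open>A = 1\<close> the integral is at most
  \<open>2 * tail_const\<close>, and adding 1 gives a dilation factor that is also at least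
  1.\<close>

definition norm_const :: real where
  "norm_const = 2 * (2 * tail_const + 1)"

lemma norm_const_ge_1: "1 \<le> norm_const"
  using tail_const_nonneg by (simp add: norm_const_def)

lemma orlicz_norm_le_weak_orlicz_norm:
  assumes P: "exp_young_orlicz \<Phi>" and M: "prob_space M" and f: "f \<in> borel_measurable M"
  shows "ennreal (1 / norm_const) * orlicz_norm M \<Phi> f \<le> weak_orlicz_norm M \<Phi> f"
  unfolding weak_orlicz_norm_def
proof (rule INF_greatest)
  fix c assume "c \<in> {c. 0 < c \<and> weak_sup M \<Phi> f c \<le> 1}"
  then have c: "0 < c" "weak_sup M \<Phi> f c \<le> ennreal 1" by auto
  have "(\<integral>\<^sup>+ x. ennreal (\<Phi> (\<bar>f x\<bar> / (2 * c))) \<partial>M) \<le> ennreal (2 * tail_const)"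
    using nn_integral_le_weak_sup[OF P M f c(1) _ c(2)] by simp
  then have "orlicz_norm M \<Phi> f \<le> ennreal (2 * c * (2 * tail_const + 1))"
    using c tail_const_nonneg by (intro orlicz_norm_le_of_nn_integral[OF P _ _ _ _ f]) auto
  then have "orlicz_norm M \<Phi> f \<le> ennreal (norm_const * c)"
    by (simp add: norm_const_def mult_ac)
  then have "ennreal (1 / norm_const) * orlicz_norm M \<Phi> f \<le>
      ennreal (1 / norm_const) * ennreal (norm_const * c)"
    by (rule mult_left_mono) simp
  also have "\<dots> = ennreal c"
    using norm_const_ge_1 by (simp add: ennreal_mult'[symmetric])
  finally show "ennreal (1 / norm_const) * orlicz_norm M \<Phi> f \<le> ennreal c" .
qed

lemma weak_orlicz_L_eq:
  assumes P: "exp_young_orlicz \<Phi>" and M: "prob_space M"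
  shows "weak_orlicz_L M \<Phi> = orlicz_space M \<Phi>"
proof -
  have "weak_orlicz_norm M \<Phi> f < \<infinity> \<longleftrightarrow> orlicz_norm M \<Phi> f < \<infinity>" if f: "f \<in> borel_measurable M" for f
  proof
    assume "weak_orlicz_norm M \<Phi> f < \<infinity>"
    then have "ennreal (1 / norm_const) * orlicz_norm M \<Phi> f < \<infinity>"
      using orlicz_norm_le_weak_orlicz_norm[OF P M f] by (rule le_less_trans[rotated])
    moreover have "0 < ennreal (1 / norm_const)" using norm_const_ge_1 by simp
    ultimately show "orlicz_norm M \<Phi> f < \<infinity>"
      by (auto simp: ennreal_mult_less_top)
  qed (rule le_less_trans[OF weak_orlicz_norm_le_orlicz_norm[OF P M f]])
  then show ?thesis unfolding weak_orlicz_L_def orlicz_space_def by auto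
qed

text \<open>The constants are the same for all measurable functions, so one statement serves both
  spaces.\<close>

lemma equivalent_on_orlicz_norms:
  assumes P: "exp_young_orlicz \<Phi>" and M: "prob_space M" and S: "S \<subseteq> borel_measurable M"
  shows "equivalent_on S (orlicz_norm M \<Phi>) (weak_orlicz_norm M \<Phi>)"
  unfolding equivalent_on_def
proof (intro exI conjI ballI)
  show "0 < 1 / norm_const" "1 / norm_const \<le> 1" using norm_const_ge_1 by auto
  fix f assume "f \<in> S"
  then have f: "f \<in> borel_measurable M" using S by auto
  show "ennreal (1 / norm_const) * orlicz_norm M \<Phi> f \<le> weak_orlicz_norm M \<Phi> f"
    by (rule orlicz_norm_le_weak_orlicz_norm[OF P M f])
  show "weak_orlicz_norm M \<Phi> f \<le> ennreal 1 * orlicz_norm M \<Phi> f"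
    using weak_orlicz_norm_le_orlicz_norm[OF P M f] by simp
qed

section \<open>Approximation by bounded functions\<close>

lemma nn_integral_finite_of_weak_sup:
  assumes P: "exp_young_orlicz \<Phi>" and M: "prob_space M" and f: "f \<in> borel_measurable M" and c: "0 < c"
    and w: "weak_sup M \<Phi> f c < \<infinity>"
  obtains B where "(\<integral>\<^sup>+ x. ennreal (\<Phi> (\<bar>f x\<bar> / (2 * c))) \<partial>M) \<le> ennreal B"
proof -
  obtain A where "0 \<le> A" "weak_sup M \<Phi> f c = ennreal A"
    using w by (cases "weak_sup M \<Phi> f c") auto
  then show ?thesis using that nn_integral_le_weak_sup[OF P M f c, of A] by auto
qed

text \<open>The remainder is \<open>f\<close> where \<open>\<bar>f\<bar> > n\<close> and 0
  elsewhere. Its integrals are dominated by the finite one for \<open>f\<close>, so they tend to 0.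
  The scale \<open>u\<close> stays fixed: the norm is at most \<open>u\<close> as soon as the
  integral falls below 1.\<close>

lemma truncation_orlicz_norm_small:
  assumes P: "exp_young_orlicz \<Phi>" and f: "f \<in> borel_measurable M" and u: "0 < u"
    and fin: "(\<integral>\<^sup>+ x. ennreal (\<Phi> (\<bar>f x\<bar> / u)) \<partial>M) < \<infinity>"
  shows "\<exists>n::nat. orlicz_norm M \<Phi> (\<lambda>x. f x - (if \<bar>f x\<bar> \<le> real n then f x else 0)) \<le> ennreal u"
proof -
  note [measurable] = f exp_young_orlicz_measurable[OF P]
  define h where "h n x = f x - (if \<bar>f x\<bar> \<le> real n then f x else 0)" for n :: nat and x
  have [measurable]: "h n \<in> borel_measurable M" for n unfolding h_def by measurable
  note z = exp_young_orlicz_zero[OF P]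
  have "(\<lambda>n. \<integral>\<^sup>+ x. ennreal (\<Phi> (\<bar>h n x\<bar> / u)) \<partial>M) \<longlonglongrightarrow> (\<integral>\<^sup>+ x. 0 \<partial>M)"
  proof (rule nn_integral_dominated_convergence[where w = "\<lambda>x. ennreal (\<Phi> (\<bar>f x\<bar> / u))"])
    show "AE x in M. ennreal (\<Phi> (\<bar>h n x\<bar> / u)) \<le> ennreal (\<Phi> (\<bar>f x\<bar> / u))" for n
      using z by (auto simp: h_def)
    have "(\<lambda>n. ennreal (\<Phi> (\<bar>h n x\<bar> / u))) \<longlonglongrightarrow> 0" for x
    \<comment> \<open>At a fixed point the remainder is exactly 0 once
      \<open>n \<ge> \<bar>f x\<bar>\<close>, and \<open>\<Phi> 0 = 0\<close>.\<close>
    proof (rule tendsto_eventually)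
      obtain N :: nat where "\<bar>f x\<bar> \<le> real N" using real_arch_simple by blast
      then have "\<And>n. n \<ge> N \<Longrightarrow> ennreal (\<Phi> (\<bar>h n x\<bar> / u)) = 0"
        using z by (auto simp: h_def)
      then show "\<forall>\<^sub>F n in sequentially. ennreal (\<Phi> (\<bar>h n x\<bar> / u)) = 0"
        by (auto simp: eventually_sequentially)
    qed
    then show "AE x in M. (\<lambda>n. ennreal (\<Phi> (\<bar>h n x\<bar> / u))) \<longlonglongrightarrow> 0" by simp
  qed (use fin in measurable)
  then have "\<forall>\<^sub>F n in sequentially. (\<integral>\<^sup>+ x. ennreal (\<Phi> (\<bar>h n x\<bar> / u)) \<partial>M) < 1"
    by (intro order_tendstoD) auto
  then obtain n where "(\<integral>\<^sup>+ x. ennreal (\<Phi> (\<bar>h n x\<bar> / u)) \<partial>M) < 1"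
    by (auto simp: eventually_sequentially)
  then have "orlicz_norm M \<Phi> (h n) \<le> ennreal u"
    by (intro orlicz_norm_le u) simp
  then show ?thesis unfolding h_def by blast
qed

lemma weak_orlicz_M_subset_orlicz_E:
  assumes P: "exp_young_orlicz \<Phi>" and M: "prob_space M"
  shows "weak_orlicz_M M \<Phi> \<subseteq> orlicz_E M \<Phi>"
proof
  interpret prob_space M by fact
  fix f assume "f \<in> weak_orlicz_M M \<Phi>"
  then have f[measurable]: "f \<in> borel_measurable M" and w: "\<And>c. 0 < c \<Longrightarrow> weak_sup M \<Phi> f c < \<infinity>"
    by (auto simp: weak_orlicz_M_def)
  \<comment> \<open>Membership in the Orlicz space needs a single scale, here \<open>c = 1\<close>;
    approximation below uses arbitrarily small ones.\<close>
  obtain B where B: "(\<integral>\<^sup>+ x. ennreal (\<Phi> (\<bar>f x\<bar> / (2 * 1))) \<partial>M) \<le> ennreal B"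
    using nn_integral_finite_of_weak_sup[OF P M f zero_less_one w[OF zero_less_one]] .
  have "orlicz_norm M \<Phi> f \<le> ennreal (2 * 1 * max 1 B)"
    by (rule orlicz_norm_le_of_nn_integral[OF P _ B _ _ f]) auto
  then have L: "f \<in> orlicz_space M \<Phi>"
    unfolding orlicz_space_def using f by (auto intro: le_less_trans)
  have "\<exists>g \<in> bounded_measurable M. orlicz_norm M \<Phi> (\<lambda>x. f x - g x) < e" if "0 < e" for e
  proof -
    \<comment> \<open>\<open>e\<close> is an extended real and may be infinite, so a real
      \<open>d\<close> is taken below it; the factor 2 anticipates the doubled scale.\<close>
    obtain d where d: "0 < d" "ennreal (2 * d) < e"
    proof -
      obtain r where "0 < ennreal r" "ennreal r < e" "0 \<le> r"
        using dense[OF \<open>0 < e\<close>] by (metis ennreal_cases less_top not_less_iff_gr_or_eq top_greatest order.strict_trans)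
      then show ?thesis using that[of "r / 2"] by simp
    qed
    obtain B where "(\<integral>\<^sup>+ x. ennreal (\<Phi> (\<bar>f x\<bar> / (2 * d))) \<partial>M) \<le> ennreal B"
      using nn_integral_finite_of_weak_sup[OF P M f d(1) w[OF d(1)]] .
    then have "(\<integral>\<^sup>+ x. ennreal (\<Phi> (\<bar>f x\<bar> / (2 * d))) \<partial>M) < \<infinity>"
      by (auto intro: le_less_trans)
    then obtain n :: nat where n: "orlicz_norm M \<Phi> (\<lambda>x. f x - (if \<bar>f x\<bar> \<le> real n then f x else 0)) \<le> ennreal (2 * d)"
      using truncation_orlicz_norm_small[OF P f, of "2 * d"] d by auto
    have "(\<lambda>x. if \<bar>f x\<bar> \<le> real n then f x else 0) \<in> bounded_measurable M"
      unfolding bounded_measurable_def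
      by (auto simp: bounded_iff less_top[symmetric] intro!: exI[of _ "real n"])
    then show ?thesis using n d by (intro bexI) (rule le_less_trans)
  qed
  then show "f \<in> orlicz_E M \<Phi>" unfolding orlicz_E_def using L by auto
qed

lemma orlicz_E_subset_weak_orlicz_M:
  assumes P: "exp_young_orlicz \<Phi>" and M: "prob_space M"
  shows "orlicz_E M \<Phi> \<subseteq> weak_orlicz_M M \<Phi>"
proof
  interpret prob_space M by fact
  fix f assume fE: "f \<in> orlicz_E M \<Phi>"
  then have f[measurable]: "f \<in> borel_measurable M" by (auto simp: orlicz_E_def orlicz_space_def)
  have "weak_sup M \<Phi> f c < \<infinity>" if c: "0 < c" for c
  proof -
    \<comment> \<open>Half of \<open>t\<close> will be lost to \<open>g\<close>. The radius
      \<open>c / 2\<close> compensates: an admissible \<open>u < c / 2\<close> gives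
      \<open>t / c \<le> (t / 2) / u\<close>.\<close>
    have "0 < ennreal (c / 2)" using c by simp
    then obtain g where g: "g \<in> bounded_measurable M"
      and "orlicz_norm M \<Phi> (\<lambda>x. f x - g x) < ennreal (c / 2)"
      using fE unfolding orlicz_E_def by blast
    then obtain u where u: "0 < u" "ennreal u < ennreal (c / 2)"
      and i: "(\<integral>\<^sup>+ x. ennreal (\<Phi> (\<bar>f x - g x\<bar> / u)) \<partial>M) \<le> 1"
      unfolding orlicz_norm_def INF_less_iff by auto
    have uc: "u < c / 2" using u by (simp add: ennreal_less_iff)
    have [measurable]: "g \<in> borel_measurable M" using g by (simp add: bounded_measurable_def)
    obtain b where b: "0 < b" "\<And>x. x \<in> space M \<Longrightarrow> \<bar>g x\<bar> \<le> b"
      using g unfolding bounded_measurable_def bounded_pos by auto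
    have w: "weak_sup M \<Phi> (\<lambda>x. f x - g x) u \<le> ennreal 1"
      using order_trans[OF weak_sup_le_nn_integral[OF P M _ u(1), of "\<lambda>x. f x - g x"] i] by simp
    \<comment> \<open>For \<open>t \<ge> 2 * b\<close> the bounded part accounts for at most
      \<open>t / 2\<close>, and the tail of \<open>f - g\<close> at \<open>t / 2\<close> gives the
      bound 1. For smaller \<open>t\<close> the tail is at most 1 and monotonicity gives
      \<open>\<Phi> (2 * b / c)\<close>.\<close>
    have "\<Phi> (t / c) * tail_fun M f t \<le> max 1 (\<Phi> (2 * b / c))" if t: "0 < t" for t
    proof (cases "2 * b \<le> t")
      case True
      have "\<Phi> (t / c) \<le> \<Phi> (t / 2 / u)"
        using t c u uc by (intro exp_young_orlicz_mono[OF P]) (auto simp: field_simps)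
      moreover have "tail_fun M f t \<le> tail_fun M (\<lambda>x. f x - g x) (t / 2)"
        unfolding tail_fun_def
      proof (rule finite_measure_mono)
        show "{x \<in> space M. t \<le> \<bar>f x\<bar>} \<subseteq> {x \<in> space M. t / 2 \<le> \<bar>f x - g x\<bar>}"
        proof safe
          fix x assume "x \<in> space M" "t \<le> \<bar>f x\<bar>"
          then show "t / 2 \<le> \<bar>f x - g x\<bar>" using b(2)[of x] True by linarith
        qed
      qed measurable
      ultimately have "\<Phi> (t / c) * tail_fun M f t \<le> \<Phi> (t / 2 / u) * tail_fun M (\<lambda>x. f x - g x) (t / 2)"
        using t u by (intro mult_mono exp_young_orlicz_nonneg[OF P]) (auto simp: tail_fun_def)
      also have "\<dots> \<le> 1" using t by (intro weak_sup_leD[OF w]) auto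
      finally show ?thesis by simp
    next
      case False
      have "\<Phi> (t / c) \<le> \<Phi> (2 * b / c)"
        using t c False by (intro exp_young_orlicz_mono[OF P]) (auto simp: divide_right_mono)
      moreover have "0 \<le> \<Phi> (t / c)" using t c by (intro exp_young_orlicz_nonneg[OF P]) auto
      moreover have "tail_fun M f t \<le> 1" by (simp add: tail_fun_def)
      ultimately have "\<Phi> (t / c) * tail_fun M f t \<le> \<Phi> (2 * b / c)"
        by (smt (verit) mult_left_le)
      then show ?thesis by simp
    qed
    then have "weak_sup M \<Phi> f c \<le> ennreal (max 1 (\<Phi> (2 * b / c)))"
      unfolding weak_sup_def by (intro SUP_least ennreal_leI) auto
    then show ?thesis by (rule le_less_trans) simp
  qed
  then show "f \<in> weak_orlicz_M M \<Phi>" unfolding weak_orlicz_M_def using f by auto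
qed

theorem theorem3p1:
  fixes M :: "'a measure" and \<Phi> :: "real \<Rightarrow> real"
  assumes "prob_space M"
    and "exp_young_orlicz \<Phi>"
  shows "(weak_orlicz_L M \<Phi> = orlicz_space M \<Phi> \<and>
          equivalent_on (orlicz_space M \<Phi>) (orlicz_norm M \<Phi>) (weak_orlicz_norm M \<Phi>)) \<and>
         (weak_orlicz_M M \<Phi> = orlicz_E M \<Phi> \<and>
          equivalent_on (orlicz_E M \<Phi>) (orlicz_norm M \<Phi>) (weak_orlicz_norm M \<Phi>))"
proof (intro conjI)
  show "weak_orlicz_L M \<Phi> = orlicz_space M \<Phi>"
    by (rule weak_orlicz_L_eq[OF assms(2,1)])
  show "weak_orlicz_M M \<Phi> = orlicz_E M \<Phi>"
    using weak_orlicz_M_subset_orlicz_E[OF assms(2,1)] orlicz_E_subset_weak_orlicz_M[OF assms(2,1)]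
    by (rule subset_antisym)
qed (rule equivalent_on_orlicz_norms[OF assms(2,1)],
    auto simp: orlicz_E_def orlicz_space_def)+

end
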